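(* For every non-constant monotone graph property $P$ on $n$-vertex directed graphs, $Q_2(P)\in\Omega(\sqrt{n})$. Moreover, there is a non-constant monotone graph property $P$ such that $Q_2(P)\in O(n)$.
   Context: An $n$-vertex directed graph is represented by $N=n(n-1)$ bits, one per possible edge $(i,j)$, $i\ne j$. A graph property is a function $P:\{0,1\}^{n(n-1)}\to\{0,1\}$ invariant under permutations of the vertices; it is monotone if adding edges cannot change the value from 1 to 0, and non-constant if it takes both values. In the quantum query model the input bits are accessed only via the gate $|j,b\rangle\mapsto|j,b\oplus x_j\rangle$ interleaved with input-independent unitaries; $Q_2(P)$ is the minimal worst-case number of queries of a quantum algorithm that outputs $P(x)$ with probability $\ge 2/3$ on every input. *)

theory Defs
  imports "HOL-Library.Extended_Real" "HOL-Combinatorics.Permutations"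
begin

section \<open>The quantum query model\<close>

text \<open>
  An input in \<open>{0,1}^I\<close> is encoded as the subset \<open>x \<subseteq> I\<close> of the indices of its 1-bits, so the
  bit \<open>x\<^sub>j\<close> is \<open>j \<in> x\<close>. The state space of an algorithm has the orthonormal basis of all
  \<open>|j,b,z\<rangle>\<close> with a query index \<open>j \<in> I\<close>, an answer bit \<open>b\<close> and a workspace content \<open>z < w\<close>.
  Vectors and matrices are functions on basis labels; only their values on \<open>qbasis I w\<close> matter.
\<close>

type_synonym 'i qlabel = "'i \<times> bool \<times> nat"
type_synonym 'i qvec = "'i qlabel \<Rightarrow> complex"
type_synonym 'i qmat = "'i qlabel \<Rightarrow> 'i qlabel \<Rightarrow> complex"

definition qbasis :: "'i set \<Rightarrow> nat \<Rightarrow> 'i qlabel set" where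
  "qbasis I w = I \<times> UNIV \<times> {..<w}"

definition unitary_on :: "'i qlabel set \<Rightarrow> 'i qmat \<Rightarrow> bool" where
  "unitary_on B U \<longleftrightarrow>
     (\<forall>u\<in>B. \<forall>v\<in>B. (\<Sum>k\<in>B. cnj (U k u) * U k v) = (if u = v then 1 else 0))"

definition apply_mat :: "'i qlabel set \<Rightarrow> 'i qmat \<Rightarrow> 'i qvec \<Rightarrow> 'i qvec" where
  "apply_mat B U \<psi> = (\<lambda>u. \<Sum>v\<in>B. U u v * \<psi> v)"

definition ket :: "'i qlabel \<Rightarrow> 'i qvec" where
  "ket u = (\<lambda>v. if v = u then 1 else 0)"

text \<open>
  The query gate is the linear map \<open>|j,b,z\<rangle> \<mapsto> |j, b \<oplus> x\<^sub>j, z\<rangle>\<close>. This map on labels is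
  its own inverse, so the new amplitude of \<open>|j,b,z\<rangle>\<close> is the old one of \<open>|j, b \<oplus> x\<^sub>j, z\<rangle>\<close>;
  on \<^typ>\<open>bool\<close>, \<open>\<noteq>\<close> is exclusive or.
\<close>

definition query_gate :: "'i set \<Rightarrow> 'i qvec \<Rightarrow> 'i qvec" where
  "query_gate x \<psi> = (\<lambda>(j, b, z). \<psi> (j, b \<noteq> (j \<in> x), z))"

primrec qstate ::
  "'i qlabel set \<Rightarrow> (nat \<Rightarrow> 'i qmat) \<Rightarrow> 'i qlabel \<Rightarrow> 'i set \<Rightarrow> nat \<Rightarrow> 'i qvec" where
  "qstate B U s x 0 = apply_mat B (U 0) (ket s)"
| "qstate B U s x (Suc t) = apply_mat B (U (Suc t)) (query_gate x (qstate B U s x t))"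

text \<open>
  After the last unitary the state is measured in the computational basis; the output is a fixed
  Boolean function \<open>out\<close> of the observed label.
\<close>

definition output_prob ::
  "'i qlabel set \<Rightarrow> ('i qlabel \<Rightarrow> bool) \<Rightarrow> 'i qvec \<Rightarrow> bool \<Rightarrow> real" where
  "output_prob B out \<psi> r = (\<Sum>v | v \<in> B \<and> out v = r. (cmod (\<psi> v))\<^sup>2)"

definition bounded_error_computable :: "'i set \<Rightarrow> ('i set \<Rightarrow> bool) \<Rightarrow> nat \<Rightarrow> bool" where
  "bounded_error_computable I f T \<longleftrightarrow>
     (\<exists>w U s out.
        s \<in> qbasis I w \<and>
        (\<forall>t\<le>T. unitary_on (qbasis I w) (U t)) \<and>
        (\<forall>x\<subseteq>I. output_prob (qbasis I w) out (qstate (qbasis I w) U s x T) (f x) \<ge> 2/3))"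

text \<open>
  The minimum is taken in \<^typ>\<open>enat\<close>, so that it would be \<open>\<infinity>\<close> (and not some default number)
  in the absence of any algorithm.
\<close>

definition Q2 :: "'i set \<Rightarrow> ('i set \<Rightarrow> bool) \<Rightarrow> enat" where
  "Q2 I f = Inf (enat ` {T. bounded_error_computable I f T})"

section \<open>Properties of directed graphs\<close>

text \<open>
  The vertices are \<open>0, \<dots>, n - 1\<close>, and a graph is the set of its edges. Properties are total
  functions, of which only the values on subsets of \<open>all_edges n\<close> matter.
\<close>

definition all_edges :: "nat \<Rightarrow> (nat \<times> nat) set" where
  "all_edges n = {(i, j). i < n \<and> j < n \<and> i \<noteq> j}"

definition graph_property :: "nat \<Rightarrow> ((nat \<times> nat) set \<Rightarrow> bool) \<Rightarrow> bool" where
  "graph_property n P \<longleftrightarrow>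
     (\<forall>\<pi> G. \<pi> permutes {..<n} \<longrightarrow> G \<subseteq> all_edges n \<longrightarrow> P (map_prod \<pi> \<pi> ` G) = P G)"

definition monotone_property :: "nat \<Rightarrow> ((nat \<times> nat) set \<Rightarrow> bool) \<Rightarrow> bool" where
  "monotone_property n P \<longleftrightarrow>
     (\<forall>G H. G \<subseteq> H \<longrightarrow> H \<subseteq> all_edges n \<longrightarrow> P G \<longrightarrow> P H)"

definition nonconstant_property :: "nat \<Rightarrow> ((nat \<times> nat) set \<Rightarrow> bool) \<Rightarrow> bool" where
  "nonconstant_property n P \<longleftrightarrow>
     (\<exists>G\<subseteq>all_edges n. P G) \<and> (\<exists>G\<subseteq>all_edges n. \<not> P G)"

definition nonconst_mono_graph_property :: "nat \<Rightarrow> ((nat \<times> nat) set \<Rightarrow> bool) \<Rightarrow> bool" where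
  "nonconst_mono_graph_property n P \<longleftrightarrow>
     graph_property n P \<and> monotone_property n P \<and> nonconstant_property n P"

end

theory Submission
  imports Defs "HOL-Analysis.L2_Norm" "HOL-Analysis.Convex"
begin

text \<open>
  For the lower bound, let \<open>G\<close> be a minimal graph with the property and \<open>H\<close> a maximal graph without
  it. No copy of \<open>G\<close> lies inside \<open>H\<close>, so the edges of \<open>G\<close> and of the complement of \<open>H\<close> have more than
  \<open>n\<close> endpoints altogether, and one of the two has more than \<open>n/4\<close> edges. All edges of \<open>G\<close> are
  sensitive at \<open>G\<close>, all edges missing from \<open>H\<close> are sensitive at \<open>H\<close>, and the hybrid argument shows
  that \<open>k\<close> sensitive bits force \<open>\<Omega>(\<surd>k)\<close> queries.

  For the upper bound, deciding whether a graph has an edge is a search among \<open>n(n - 1)\<close> bits. Instead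
  of finding an edge, the algorithm measures the overlap with the initial state of a superposition
  over the number of Grover iterations performed.
\<close>

section \<open>The hybrid argument\<close>

abbreviation qnorm :: "'i qlabel set \<Rightarrow> 'i qvec \<Rightarrow> real" where
  "qnorm B \<psi> \<equiv> L2_set (\<lambda>v. cmod (\<psi> v)) B"

lemma qnorm_square: "(qnorm B \<psi>)\<^sup>2 = (\<Sum>v\<in>B. (cmod (\<psi> v))\<^sup>2)"
  by (simp add: L2_set_def sum_nonneg)

lemma qnorm_add_le: "qnorm B (\<lambda>v. \<psi> v + \<phi> v) \<le> qnorm B \<psi> + qnorm B \<phi>"
  by (rule order_trans[OF L2_set_mono L2_set_triangle_ineq]) (auto simp: norm_triangle_ineq)

lemma finite_qbasis: "finite I \<Longrightarrow> finite (qbasis I w)"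
  by (simp add: qbasis_def)

text \<open>Expand the squares and sum over the row index first: this leaves the Gram matrix of the
  columns of \<open>U\<close>, which is the identity.\<close>

lemma qnorm_apply_mat:
  assumes "finite B" and U: "unitary_on B U"
  shows "qnorm B (apply_mat B U \<psi>) = qnorm B \<psi>"
proof -
  have "complex_of_real (\<Sum>u\<in>B. (cmod (apply_mat B U \<psi> u))\<^sup>2) =
      (\<Sum>u\<in>B. cnj (\<Sum>v\<in>B. U u v * \<psi> v) * (\<Sum>k\<in>B. U u k * \<psi> k))"
    unfolding of_real_sum complex_norm_square apply_mat_def by (simp add: mult.commute del: cnj_sum)
  also have "\<dots> = (\<Sum>u\<in>B. \<Sum>v\<in>B. \<Sum>k\<in>B. cnj (\<psi> v) * \<psi> k * (cnj (U u v) * U u k))"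
    unfolding cnj_sum sum_product by (simp add: mult_ac)
  also have "\<dots> = (\<Sum>v\<in>B. \<Sum>k\<in>B. \<Sum>u\<in>B. cnj (\<psi> v) * \<psi> k * (cnj (U u v) * U u k))"
    by (subst sum.swap) (intro sum.cong refl sum.swap)
  also have "\<dots> = (\<Sum>v\<in>B. \<Sum>k\<in>B. cnj (\<psi> v) * \<psi> k * (if v = k then 1 else 0))"
    using U by (simp add: unitary_on_def flip: sum_distrib_left)
  also have "\<dots> = complex_of_real (\<Sum>v\<in>B. (cmod (\<psi> v))\<^sup>2)"
    unfolding of_real_sum complex_norm_square
    using \<open>finite B\<close> by (simp add: mult.commute if_distrib cong: if_cong)
  finally have "(\<Sum>u\<in>B. (cmod (apply_mat B U \<psi> u))\<^sup>2) = (\<Sum>v\<in>B. (cmod (\<psi> v))\<^sup>2)"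
    using of_real_eq_iff by blast
  then show ?thesis
    by (simp add: L2_set_def)
qed

lemma apply_mat_diff:
  "apply_mat B U \<psi> u - apply_mat B U \<phi> u = apply_mat B U (\<lambda>v. \<psi> v - \<phi> v) u"
  by (simp add: apply_mat_def right_diff_distrib sum_subtractf)

text \<open>The gate permutes labels without moving the query index, so any index set will do; the
  singleton \<open>{i}\<close> is used below.\<close>

lemma qnorm_query_gate: "qnorm (qbasis I w) (query_gate x \<psi>) = qnorm (qbasis I w) \<psi>"
proof -
  let ?f = "\<lambda>(j, b, z). (j, b \<noteq> (j \<in> x), z)"
  have "bij_betw ?f (qbasis I w) (qbasis I w)"
    by (rule bij_betw_byWitness[where f' = ?f]) (auto simp: qbasis_def)
  from sum.reindex_bij_betw[OF this, of "\<lambda>v. (cmod (\<psi> v))\<^sup>2"]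
  have "(\<Sum>v\<in>qbasis I w. (cmod (query_gate x \<psi> v))\<^sup>2) = (\<Sum>v\<in>qbasis I w. (cmod (\<psi> v))\<^sup>2)"
    by (simp add: query_gate_def case_prod_unfold)
  then show ?thesis
    by (simp add: L2_set_def)
qed

lemma query_gate_diff:
  "query_gate x \<psi> u - query_gate x \<phi> u = query_gate x (\<lambda>v. \<psi> v - \<phi> v) u"
  by (simp add: query_gate_def case_prod_unfold)

lemma qnorm_qstate:
  assumes "finite I" "s \<in> qbasis I w" "\<forall>t\<le>T. unitary_on (qbasis I w) (U t)" "t \<le> T"
  shows "qnorm (qbasis I w) (qstate (qbasis I w) U s x t) = 1"
  using \<open>t \<le> T\<close>
proof (induction t)
  case 0
  have "(\<Sum>v\<in>qbasis I w. (cmod (ket s v))\<^sup>2) = (\<Sum>v\<in>qbasis I w. if v = s then 1 else 0)"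
    by (intro sum.cong) (auto simp: ket_def)
  then have "qnorm (qbasis I w) (ket s) = 1"
    using assms by (simp add: L2_set_def finite_qbasis)
  then show ?case
    using assms by (simp add: qnorm_apply_mat finite_qbasis)
next
  case (Suc t)
  then show ?case
    using assms by (simp add: qnorm_apply_mat finite_qbasis qnorm_query_gate)
qed

text \<open>The gates of \<open>x\<close> and \<open>y\<close> act differently only on labels that query \<open>i\<close>.\<close>

lemma query_gate_change_one_bit:
  assumes "finite I" "i \<in> I" and xy: "\<And>j. j \<noteq> i \<Longrightarrow> j \<in> x \<longleftrightarrow> j \<in> y"
  shows "qnorm (qbasis I w) (\<lambda>v. query_gate x \<psi> v - query_gate y \<psi> v)
       \<le> 2 * qnorm (qbasis {i} w) \<psi>"
proof -
  let ?D = "\<lambda>v. query_gate x \<psi> v - query_gate y \<psi> v"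
  have "(\<Sum>v\<in>qbasis {i} w. (cmod (?D v))\<^sup>2) = (\<Sum>v\<in>qbasis I w. (cmod (?D v))\<^sup>2)"
    using assms by (intro sum.mono_neutral_left)
      (auto simp: finite_qbasis, auto simp: qbasis_def query_gate_def)
  then have "qnorm (qbasis I w) ?D = qnorm (qbasis {i} w) ?D"
    by (simp add: L2_set_def)
  also have "\<dots> \<le> qnorm (qbasis {i} w) (query_gate x \<psi>)
      + qnorm (qbasis {i} w) (\<lambda>v. - query_gate y \<psi> v)"
    using qnorm_add_le[of "query_gate x \<psi>" "\<lambda>v. - query_gate y \<psi> v" "qbasis {i} w"] by simp
  also have "\<dots> = 2 * qnorm (qbasis {i} w) \<psi>"
    by (simp add: qnorm_query_gate)
  finally show ?thesis .
qed

text \<open>Unitaries preserve the distance of the two runs, and each query adds at most the effect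
  of one changed gate. All weights are taken along the run on \<open>y\<close>, so a single run
  serves every \<open>i\<close>.\<close>

lemma qstate_distance:
  assumes "finite I" "i \<in> I" and xy: "\<And>j. j \<noteq> i \<Longrightarrow> j \<in> x \<longleftrightarrow> j \<in> y"
    and U: "\<forall>t\<le>T. unitary_on (qbasis I w) (U t)" and "t \<le> T"
  shows "qnorm (qbasis I w) (\<lambda>v. qstate (qbasis I w) U s x t v - qstate (qbasis I w) U s y t v)
       \<le> 2 * (\<Sum>r<t. qnorm (qbasis {i} w) (qstate (qbasis I w) U s y r))"
  using \<open>t \<le> T\<close>
proof (induction t)
  case 0
  then show ?case by (simp add: L2_set_def)
next
  case (Suc t)
  let ?B = "qbasis I w" and ?\<psi> = "\<lambda>x. qstate (qbasis I w) U s x t"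
  have "qnorm ?B (\<lambda>v. qstate ?B U s x (Suc t) v - qstate ?B U s y (Suc t) v)
      = qnorm ?B (\<lambda>v. query_gate x (?\<psi> x) v - query_gate y (?\<psi> y) v)"
    using Suc.prems U assms(1) by (simp add: apply_mat_diff qnorm_apply_mat finite_qbasis)
  \<comment> \<open>Insert the hybrid term: the gate of \<open>x\<close> applied to the state of
    \<open>y\<close>.\<close>
  also have "\<dots> = qnorm ?B (\<lambda>v. query_gate x (\<lambda>v. ?\<psi> x v - ?\<psi> y v) v
      + (query_gate x (?\<psi> y) v - query_gate y (?\<psi> y) v))"
    by (simp flip: query_gate_diff)
  also have "\<dots> \<le> qnorm ?B (query_gate x (\<lambda>v. ?\<psi> x v - ?\<psi> y v))
      + qnorm ?B (\<lambda>v. query_gate x (?\<psi> y) v - query_gate y (?\<psi> y) v)"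
    by (rule qnorm_add_le)
  also have "\<dots> \<le> 2 * (\<Sum>r<t. qnorm (qbasis {i} w) (qstate ?B U s y r))
      + 2 * qnorm (qbasis {i} w) (?\<psi> y)"
    unfolding qnorm_query_gate
    using Suc query_gate_change_one_bit[OF assms(1-3)] by (intro add_mono) auto
  finally show ?case by simp
qed

lemma output_prob_complement:
  assumes "finite B"
  shows "output_prob B out \<psi> r + output_prob B out \<psi> (\<not> r) = (qnorm B \<psi>)\<^sup>2"
proof -
  have "B = {v \<in> B. out v = r} \<union> {v \<in> B. out v = (\<not> r)}" by auto
  then have "(\<Sum>v\<in>B. (cmod (\<psi> v))\<^sup>2) = (\<Sum>v\<in>{v \<in> B. out v = r} \<union> {v \<in> B. out v = (\<not> r)}. (cmod (\<psi> v))\<^sup>2)"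
    by simp
  also have "\<dots> = output_prob B out \<psi> r + output_prob B out \<psi> (\<not> r)"
    unfolding output_prob_def using assms by (intro sum.union_disjoint) auto
  finally show ?thesis
    by (simp add: qnorm_square)
qed

text \<open>Project onto the labels with output \<open>r\<close>: the projection of
  \<open>\<phi>\<close> has norm at least sqrt(2/3) > 4/5, that of \<open>\<psi>\<close> at most
  sqrt(1/3) < 3/5.\<close>

lemma distinguishable_imp_distance:
  assumes "finite B" "qnorm B \<psi> = 1"
    and "output_prob B out \<phi> r \<ge> 2/3" "output_prob B out \<psi> (\<not> r) \<ge> 2/3"
  shows "qnorm B (\<lambda>v. \<phi> v - \<psi> v) \<ge> 1/5"
proof -
  define A where "A = {v \<in> B. out v = r}"
  have out: "output_prob B out \<chi> r = (qnorm A \<chi>)\<^sup>2" for \<chi>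
    by (simp add: qnorm_square output_prob_def A_def)
  have "(qnorm A \<psi>)\<^sup>2 \<le> 1/3"
    using output_prob_complement[OF assms(1), of out \<psi> r] assms(2,4) by (simp flip: out)
  also have "\<dots> \<le> (3/5)\<^sup>2" by (simp add: power2_eq_square)
  finally have 1: "qnorm A \<psi> \<le> 3/5" by (rule power2_le_imp_le) simp
  have "(4/5)\<^sup>2 \<le> (2/3 :: real)" by (simp add: power2_eq_square)
  also have "\<dots> \<le> (qnorm A \<phi>)\<^sup>2" using assms(3) by (simp flip: out)
  finally have 2: "4/5 \<le> qnorm A \<phi>" by (rule power2_le_imp_le) simp
  have "qnorm A (\<lambda>v. \<phi> v - \<psi> v) \<le> qnorm B (\<lambda>v. \<phi> v - \<psi> v)"
    unfolding L2_set_def A_def using assms(1) by (intro real_sqrt_le_mono sum_mono2) auto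
  moreover have "qnorm A \<phi> \<le> qnorm A (\<lambda>v. \<phi> v - \<psi> v) + qnorm A \<psi>"
    using qnorm_add_le[of "\<lambda>v. \<phi> v - \<psi> v" \<psi> A] by simp
  ultimately show ?thesis using 1 2 by simp
qed

text \<open>
  Every sensitive index must receive constant total query amplitude on input \<open>y\<close>, but the query
  weights of all indices add up to \<open>T\<close>.
\<close>

lemma sensitivity_bound:
  assumes fin: "finite I" and "S \<subseteq> I" "y \<subseteq> I" and f: "bounded_error_computable I f T"
    and x: "\<And>i. i \<in> S \<Longrightarrow> x i \<subseteq> I"
    and xy: "\<And>i j. i \<in> S \<Longrightarrow> j \<noteq> i \<Longrightarrow> j \<in> x i \<longleftrightarrow> j \<in> y"
    and sens: "\<And>i. i \<in> S \<Longrightarrow> f (x i) \<noteq> f y"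
  shows "sqrt (card S) \<le> 10 * real T"
proof -
  obtain w U s out where s: "s \<in> qbasis I w"
    and U: "\<forall>t\<le>T. unitary_on (qbasis I w) (U t)"
    and out: "\<forall>x\<subseteq>I. output_prob (qbasis I w) out (qstate (qbasis I w) U s x T) (f x) \<ge> 2/3"
    using f unfolding bounded_error_computable_def by blast
  define B where "B = qbasis I w"
  define \<psi> where "\<psi> = qstate B U s"
  have finB: "finite B" using fin by (simp add: B_def finite_qbasis)
  have \<psi>: "qnorm B (\<psi> z t) = 1" if "t \<le> T" for z t
    using qnorm_qstate[OF fin s U that] by (simp add: B_def \<psi>_def)
  define q where "q i t = qnorm (qbasis {i} w) (\<psi> y t)" for i t
  have "1 \<le> 100 * (real T * (\<Sum>t<T. (q i t)\<^sup>2))" if "i \<in> S" for i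
  proof -
    have neq: "f y = (\<not> f (x i))" using sens[OF that] by auto
    have "output_prob B out (\<psi> z T) (f z) \<ge> 2/3" if "z \<subseteq> I" for z
      using out that by (simp add: B_def \<psi>_def)
    from this[OF x[OF that]] this[OF assms(3)]
    have "1/5 \<le> qnorm B (\<lambda>v. \<psi> (x i) T v - \<psi> y T v)"
      unfolding neq by (intro distinguishable_imp_distance[OF finB \<psi>]) auto
    also have "\<dots> \<le> 2 * (\<Sum>t<T. q i t)"
      unfolding q_def B_def \<psi>_def
      using qstate_distance[of I i "x i" y T w U T s] fin U xy[OF that] that assms(2) by auto
    finally have "1/10 \<le> (\<Sum>t<T. q i t)" by simp
    then have "(1/10)\<^sup>2 \<le> (\<Sum>t<T. q i t)\<^sup>2" by (intro power_mono) auto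
    \<comment> \<open>Cauchy-Schwarz turns total amplitude into total weight.\<close>
    also have "\<dots> \<le> real T * (\<Sum>t<T. (q i t)\<^sup>2)"
      using sum_squared_le_sum_of_squares[of "q i" "{..<T}"] by (simp add: mult.commute)
    finally show ?thesis by (simp add: power2_eq_square)
  qed
  then have "real (card S) \<le> (\<Sum>i\<in>S. 100 * (real T * (\<Sum>t<T. (q i t)\<^sup>2)))"
    using sum_mono[of S "\<lambda>_. 1" "\<lambda>i. 100 * (real T * (\<Sum>t<T. (q i t)\<^sup>2))"] by simp
  also have "\<dots> = 100 * (real T * (\<Sum>t<T. \<Sum>i\<in>S. (q i t)\<^sup>2))"
    by (subst sum.swap) (simp add: sum_distrib_left)
  also have "\<dots> \<le> 100 * (real T * (\<Sum>t<T. 1))"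
  proof (intro mult_left_mono sum_mono)
    fix t assume "t \<in> {..<T}"
    \<comment> \<open>The sets \<open>qbasis {i} w\<close> partition the basis, so the weights at
      time \<open>t\<close> sum to the squared norm of a unit vector.\<close>
    have "(\<Sum>i\<in>S. (q i t)\<^sup>2) \<le> (\<Sum>i\<in>I. (q i t)\<^sup>2)"
      using assms fin by (intro sum_mono2) auto
    also have "\<dots> = (\<Sum>i\<in>I. \<Sum>v\<in>UNIV \<times> {..<w}. (cmod (\<psi> y t (i, v)))\<^sup>2)"
      by (simp add: q_def qnorm_square qbasis_def sum.cartesian_product' del: UNIV_Times_UNIV)
    also have "\<dots> = (qnorm B (\<psi> y t))\<^sup>2"
      by (simp add: qnorm_square B_def qbasis_def sum.cartesian_product case_prod_unfold)
    finally show "(\<Sum>i\<in>S. (q i t)\<^sup>2) \<le> 1"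
      using \<psi>[of t y] \<open>t \<in> {..<T}\<close> by simp
  qed auto
  finally have "real (card S) \<le> (10 * real T)\<^sup>2"
    by (simp add: power2_eq_square)
  then show ?thesis
    by (intro real_le_lsqrt) auto
qed

section \<open>Minimal and maximal graphs\<close>

lemma finite_all_edges: "finite (all_edges n)"
  by (rule finite_subset[of _ "{..<n} \<times> {..<n}"]) (auto simp: all_edges_def)

text \<open>Extend a bijection from \<open>A\<close> onto a subset of \<open>C\<close> by one
  between the complements, which are equally large.\<close>

lemma exists_permutes_into:
  assumes "finite V" "A \<subseteq> V" "C \<subseteq> V" "card A \<le> card C"
  shows "\<exists>\<pi>. \<pi> permutes V \<and> \<pi> ` A \<subseteq> C"
proof -
  obtain C' where C': "C' \<subseteq> C" "card C' = card A"
    using obtain_subset_with_card_n[OF assms(4)] by blast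
  have fin: "finite A" "finite C'" using assms C' by (auto intro: finite_subset)
  have "card (V - A) = card (V - C')"
    using assms C' fin by (simp add: card_Diff_subset)
  then obtain f g where f: "bij_betw f A C'" and g: "bij_betw g (V - A) (V - C')"
    using assms(1) fin C' finite_same_card_bij[of A C'] finite_same_card_bij[of "V - A" "V - C'"]
    by auto
  define \<pi> where "\<pi> v = (if v \<in> A then f v else if v \<in> V then g v else v)" for v
  have "bij_betw \<pi> A C'" "bij_betw \<pi> (V - A) (V - C')"
    using f g bij_betw_cong[of A \<pi> f C'] bij_betw_cong[of "V - A" \<pi> g "V - C'"]
    by (auto simp: \<pi>_def)
  then have "bij_betw \<pi> (A \<union> (V - A)) (C' \<union> (V - C'))"
    by (rule bij_betw_combine) auto
  moreover have "A \<union> (V - A) = V" "C' \<union> (V - C') = V"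
    using assms C' by auto
  ultimately have "\<pi> permutes V"
    using assms(2) by (intro bij_imp_permutes) (auto simp: \<pi>_def)
  moreover have "\<pi> ` A \<subseteq> C"
    using \<open>bij_betw \<pi> A C'\<close> C' by (auto simp: bij_betw_def)
  ultimately show ?thesis by blast
qed

lemma card_endpoints_le:
  assumes "finite G"
  shows "card (fst ` G \<union> snd ` G) \<le> 2 * card G"
  using card_Un_le[of "fst ` G" "snd ` G"] card_image_le[OF assms, of fst]
    card_image_le[OF assms, of snd] by linarith

text \<open>
  If \<open>G\<close> and the complement of \<open>H\<close> together had too few edges, some copy of \<open>G\<close> would avoid all
  endpoints of missing edges of \<open>H\<close>, hence lie inside \<open>H\<close>.
\<close>

lemma true_graph_vs_false_graph:
  assumes P: "graph_property n P" "monotone_property n P"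
    and G: "G \<subseteq> all_edges n" "P G" and H: "H \<subseteq> all_edges n" "\<not> P H"
  shows "n < 2 * card G + 2 * card (all_edges n - H)"
proof (rule ccontr)
  let ?E = "all_edges n - H"
  assume "\<not> n < 2 * card G + 2 * card ?E"
  define A where "A = fst ` G \<union> snd ` G"
  \<comment> \<open>The vertices that meet no missing edge: \<open>H\<close> contains every edge
    between two of them.\<close>
  define C where "C = {..<n} - (fst ` ?E \<union> snd ` ?E)"
  have fin: "finite G" "finite ?E"
    using G finite_all_edges by (auto intro: finite_subset)
  have E: "fst ` ?E \<union> snd ` ?E \<subseteq> {..<n}" by (auto simp: all_edges_def)
  have A: "A \<subseteq> {..<n}" using G by (auto simp: A_def all_edges_def)
  have "card C = n - card (fst ` ?E \<union> snd ` ?E)"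
    unfolding C_def using E fin by (subst card_Diff_subset) auto
  then have "card A \<le> card C"
    using card_endpoints_le[OF fin(1)] card_endpoints_le[OF fin(2)]
      \<open>\<not> n < 2 * card G + 2 * card ?E\<close> unfolding A_def by linarith
  then obtain \<pi> where \<pi>: "\<pi> permutes {..<n}" "\<pi> ` A \<subseteq> C"
    using exists_permutes_into[of "{..<n}" A C] A by (auto simp: C_def)
  have "map_prod \<pi> \<pi> ` G \<subseteq> H"
  proof (clarsimp)
    fix u v assume uv: "(u, v) \<in> G"
    then have "u \<in> A" "v \<in> A" by (force simp: A_def)+
    then have C: "\<pi> u \<in> C" "\<pi> v \<in> C" using \<pi> by auto
    have "\<pi> u \<noteq> \<pi> v"
      using uv G permutes_inj[OF \<pi>(1)] by (auto simp: all_edges_def inj_eq)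
    then have "(\<pi> u, \<pi> v) \<in> all_edges n" using C by (auto simp: C_def all_edges_def)
    then show "(\<pi> u, \<pi> v) \<in> H" using C by (force simp: C_def)
  qed
  moreover have "P (map_prod \<pi> \<pi> ` G)"
    using P(1) \<pi>(1) G by (auto simp: graph_property_def)
  ultimately show False
    using P(2) H by (auto simp: monotone_property_def)
qed

lemma query_lower_bound:
  assumes P: "nonconst_mono_graph_property n P" and f: "bounded_error_computable (all_edges n) P T"
  shows "sqrt n / 20 \<le> T"
proof -
  let ?E = "all_edges n"
  have P': "graph_property n P" "monotone_property n P" and nc: "nonconstant_property n P"
    using P by (auto simp: nonconst_mono_graph_property_def)
  have fin: "finite (Collect (\<lambda>G. G \<subseteq> ?E \<and> Q G))" for Q
    by (rule finite_subset[of _ "Pow ?E"]) (auto simp: finite_all_edges)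
  obtain G where G: "G \<subseteq> ?E" "P G" and Gmin: "\<And>K. K \<subseteq> ?E \<Longrightarrow> P K \<Longrightarrow> K \<subseteq> G \<Longrightarrow> G = K"
    using finite_has_minimal[OF fin[of P]] nc by (auto simp: nonconstant_property_def)
  obtain H where H: "H \<subseteq> ?E" "\<not> P H" and Hmax: "\<And>K. K \<subseteq> ?E \<Longrightarrow> \<not> P K \<Longrightarrow> H \<subseteq> K \<Longrightarrow> H = K"
    using finite_has_maximal[OF fin[of "\<lambda>G. \<not> P G"]] nc by (auto simp: nonconstant_property_def)
  have 1: "sqrt (card G) \<le> 10 * real T"
  proof (rule sensitivity_bound[OF finite_all_edges G(1) G(1) f, of "\<lambda>i. G - {i}"])
    fix i assume "i \<in> G"
    then have "\<not> P (G - {i})" using Gmin[of "G - {i}"] G by blast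
    then show "P (G - {i}) \<noteq> P G" using G by simp
  qed (use G in auto)
  have 2: "sqrt (card (?E - H)) \<le> 10 * real T"
  proof (rule sensitivity_bound[OF finite_all_edges Diff_subset H(1) f, of _ "\<lambda>i. insert i H"])
    fix i assume "i \<in> ?E - H"
    then have "P (insert i H)" using Hmax[of "insert i H"] H by blast
    then show "P (insert i H) \<noteq> P H" using H by simp
  qed (use H in auto)
  have "real (card G) \<le> (10 * real T)\<^sup>2" "real (card (?E - H)) \<le> (10 * real T)\<^sup>2"
    using 1 2 by (auto dest: sqrt_le_D)
  moreover have "real n \<le> 2 * real (card G) + 2 * real (card (?E - H))"
    using true_graph_vs_false_graph[OF P' G H] by linarith
  \<comment> \<open>Twice the two bounds \<open>100 * T^2\<close> add up to
    \<open>400 * T^2\<close>.\<close>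
  ultimately have "real n \<le> (20 * real T)\<^sup>2"
    by (simp add: power2_eq_square)
  then have "sqrt n \<le> 20 * real T"
    by (intro real_le_lsqrt) auto
  then show ?thesis by simp
qed

section \<open>Quantum search\<close>

text \<open>The Householder reflection that exchanges \<open>ket s\<close> and the real unit vector \<open>\<chi>\<close>.\<close>

definition reflection :: "'i qlabel \<Rightarrow> ('i qlabel \<Rightarrow> real) \<Rightarrow> 'i qmat" where
  "reflection s \<chi> u v = complex_of_real
     (of_bool (u = v) - (of_bool (u = s) - \<chi> u) * (of_bool (v = s) - \<chi> v) / (1 - \<chi> s))"

text \<open>The vector \<open>d = ket s - \<chi>\<close> has squared norm
  \<open>2 * (1 - \<chi> s)\<close>, so the matrix is the identity minus
  \<open>2 d d^T / |d|^2\<close>.\<close>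

lemma unitary_on_reflection:
  assumes "finite B" "s \<in> B" and \<chi>: "(\<Sum>v\<in>B. (\<chi> v)\<^sup>2) = 1" "\<chi> s \<noteq> 1"
  shows "unitary_on B (reflection s \<chi>)"
  unfolding unitary_on_def
proof (intro ballI)
  fix u v assume uv: "u \<in> B" "v \<in> B"
  define d where "d k = of_bool (k = s) - \<chi> k" for k
  define c where "c = 1 - \<chi> s"
  have c: "c \<noteq> 0" using \<chi> by (simp add: c_def)
  have "(\<Sum>k\<in>B. (d k)\<^sup>2) = (\<Sum>k\<in>B. (if k = s then 1 - 2 * \<chi> k else 0) + (\<chi> k)\<^sup>2)"
    by (intro sum.cong) (auto simp: d_def power2_eq_square algebra_simps)
  also have "\<dots> = 2 * c"
    using assms by (simp add: sum.distrib c_def)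
  finally have "(\<Sum>k\<in>B. (d k)\<^sup>2) = 2 * c" .
  then have dK: "(\<Sum>k\<in>B. (d k)\<^sup>2 * K) = 2 * c * K" for K
    by (simp flip: sum_distrib_right)
  have "(\<Sum>k\<in>B. cnj (reflection s \<chi> k u) * reflection s \<chi> k v)
      = complex_of_real (\<Sum>k\<in>B. (of_bool (k = u) - d k * d u / c) * (of_bool (k = v) - d k * d v / c))"
    by (simp add: reflection_def d_def c_def)
  also have "(\<Sum>k\<in>B. (of_bool (k = u) - d k * d u / c) * (of_bool (k = v) - d k * d v / c))
      = (\<Sum>k\<in>B. (if k = u then of_bool (u = v) - d u * d v / c else 0)
          - (if k = v then d u * d v / c else 0) + (d k)\<^sup>2 * (d u * d v / c\<^sup>2))"
    by (intro sum.cong) (auto simp: power2_eq_square algebra_simps)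
  also have "\<dots> = of_bool (u = v) - d u * d v / c - d u * d v / c + 2 * c * (d u * d v / c\<^sup>2)"
    using assms uv dK[of "d u * d v / c\<^sup>2"] by (simp add: sum.distrib sum_subtractf)
  also have "\<dots> = of_bool (u = v)"
    using c by (simp add: power2_eq_square)
  finally show "(\<Sum>k\<in>B. cnj (reflection s \<chi> k u) * reflection s \<chi> k v) = (if u = v then 1 else 0)"
    by simp
qed

lemma apply_reflection_ket:
  assumes "finite B" "s \<in> B" "\<chi> s \<noteq> 1"
  shows "apply_mat B (reflection s \<chi>) (ket s) u = \<chi> u"
proof -
  have "apply_mat B (reflection s \<chi>) (ket s) u = (\<Sum>v\<in>B. if v = s then reflection s \<chi> u s else 0)"
    unfolding apply_mat_def by (intro sum.cong) (auto simp: ket_def)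
  then show ?thesis
    using assms by (simp add: reflection_def)
qed

text \<open>Row \<open>s\<close> of the reflection is \<open>\<chi>\<close>; observing
  \<open>s\<close> afterwards therefore measures the overlap with \<open>\<chi>\<close>.\<close>

lemma apply_reflection_base:
  assumes "\<chi> s \<noteq> 1"
  shows "apply_mat B (reflection s \<chi>) \<psi> s = (\<Sum>v\<in>B. \<chi> v * \<psi> v)"
  unfolding apply_mat_def
proof (intro sum.cong refl arg_cong2[where f = "(*)"])
  show "reflection s \<chi> s v = \<chi> v" for v
    using assms by (auto simp: reflection_def)
qed

lemma sum_qbasis_slice:
  assumes "finite I" "z < w"
  shows "(\<Sum>v\<in>qbasis I w. if snd v = (b, z) then h (fst v) else 0) = (\<Sum>j\<in>I. h j)"
proof -
  have "(\<Sum>v\<in>qbasis I w. if snd v = (b, z) then h (fst v) else 0)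
      = (\<Sum>v\<in>(\<lambda>j. (j, b, z)) ` I. h (fst v))"
    using assms by (intro sum.mono_neutral_cong_right) (auto simp: finite_qbasis, auto simp: qbasis_def)
  also have "\<dots> = (\<Sum>j\<in>I. h j)"
    by (subst sum.reindex) (auto simp: inj_on_def)
  finally show ?thesis .
qed

section \<open>Grover's recursion over the reals\<close>

definition bit_sign :: "bool \<Rightarrow> real" where
  "bit_sign b = (if b then -1 else 1)"

lemma bit_sign_square [simp]: "bit_sign b * bit_sign b = 1" "bit_sign b * (bit_sign b * r) = r"
  by (auto simp: bit_sign_def)

text \<open>Phase kickback: \<open>bit_sign\<close> gives the unnormalised amplitudes of |->, and a
  query multiplies them by the sign of the queried bit.\<close>

lemma bit_sign_xor: "bit_sign (b = (\<not> c)) = bit_sign b * bit_sign c"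
  by (auto simp: bit_sign_def)

text \<open>
  The amplitudes of Grover's search, scaled by \<open>sqrt (card I)\<close>: a phase query followed by the
  reflection about the uniform superposition.
\<close>

primrec grover :: "'i set \<Rightarrow> 'i set \<Rightarrow> nat \<Rightarrow> 'i \<Rightarrow> real" where
  "grover I x 0 j = 1"
| "grover I x (Suc m) j =
     2 / card I * (\<Sum>i\<in>I. bit_sign (i \<in> x) * grover I x m i) - bit_sign (j \<in> x) * grover I x m j"

lemma grover_empty:
  assumes "finite I" "I \<noteq> {}"
  shows "grover I {} m j = 1"
proof -
  have "card I \<noteq> 0" using assms by simp
  then show ?thesis
    by (induction m arbitrary: j) (simp_all add: bit_sign_def)
qed

text \<open>Sign flips keep the norm; in the reflection, \<open>card I * a^2\<close> cancels the
  cross term \<open>2 * a * \<sigma>\<close>.\<close>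

lemma grover_norm:
  assumes "finite I" "I \<noteq> {}"
  shows "(\<Sum>j\<in>I. (grover I x m j)\<^sup>2) = card I"
proof (induction m)
  case (Suc m)
  define g where "g j = bit_sign (j \<in> x) * grover I x m j" for j
  define \<sigma> where "\<sigma> = (\<Sum>i\<in>I. g i)"
  define a where "a = 2 / card I * \<sigma>"
  have "(\<Sum>j\<in>I. (grover I x (Suc m) j)\<^sup>2) = (\<Sum>j\<in>I. (a - g j)\<^sup>2)"
    by (simp add: g_def \<sigma>_def a_def)
  also have "\<dots> = (\<Sum>j\<in>I. a\<^sup>2 - 2 * a * g j + (g j)\<^sup>2)"
    by (simp add: power2_diff algebra_simps)
  also have "\<dots> = card I * a\<^sup>2 - 2 * a * \<sigma> + (\<Sum>j\<in>I. (g j)\<^sup>2)"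
    by (simp add: sum.distrib sum_subtractf \<sigma>_def sum_distrib_left)
  also have "\<dots> = (\<Sum>j\<in>I. (g j)\<^sup>2)"
    using assms by (simp add: a_def power2_eq_square)
  also have "\<dots> = (\<Sum>j\<in>I. (grover I x m j)\<^sup>2)"
    by (intro sum.cong) (auto simp: g_def bit_sign_def)
  finally show ?case using Suc by simp
qed simp

text \<open>At a marked item the recursion only adds the mean, so the means telescope.\<close>

lemma grover_sum_overlap:
  assumes "j \<in> x"
  shows "2 / card I * (\<Sum>m<T. \<Sum>i\<in>I. bit_sign (i \<in> x) * grover I x m i) = grover I x T j - 1"
  using assms by (induction T) (simp_all add: bit_sign_def distrib_left)

text \<open>The telescoped sum is governed by a single entry of a vector of squared norm
  \<open>card I\<close>.\<close>

lemma grover_sum_overlap_le: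
  assumes "finite I" "j \<in> x" "x \<subseteq> I"
  shows "\<bar>\<Sum>m<T. \<Sum>i\<in>I. bit_sign (i \<in> x) * grover I x m i\<bar> \<le> card I * (sqrt (card I) + 1) / 2"
proof -
  let ?S = "\<Sum>m<T. \<Sum>i\<in>I. bit_sign (i \<in> x) * grover I x m i"
  have ne: "I \<noteq> {}" and N: "card I \<noteq> 0" using assms by auto
  have "(grover I x T j)\<^sup>2 \<le> (\<Sum>j\<in>I. (grover I x T j)\<^sup>2)"
    using assms by (intro member_le_sum) auto
  then have "\<bar>grover I x T j\<bar> \<le> sqrt (card I)"
    using grover_norm[OF assms(1) ne, of x T] by (simp add: real_le_rsqrt)
  then have "\<bar>2 / card I * ?S\<bar> \<le> sqrt (card I) + 1"
    unfolding grover_sum_overlap[OF assms(2)] by linarith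
  then show ?thesis
    using N by (simp add: abs_mult field_simps)
qed

section \<open>Grover steps as unitaries\<close>

text \<open>Each block of fixed answer bit and branch is reflected about its uniform vector; then
  branch \<open>t\<close> gets a sign on its answer bit, which turns |+> into |->.\<close>

definition grover_step :: "'i set \<Rightarrow> nat \<Rightarrow> 'i qmat" where
  "grover_step I t u v = complex_of_real
     ((if snd (snd u) = t then bit_sign (fst (snd u)) else 1) *
      (if snd v = snd u then 2 / card I - of_bool (fst v = fst u) else 0))"

text \<open>The signs depend only on the row and cancel; each block is a real symmetric reflection,
  hence its own inverse.\<close>

lemma unitary_on_grover_step:
  assumes "finite I"
  shows "unitary_on (qbasis I w) (grover_step I t)"
  unfolding unitary_on_def
proof (intro ballI)
  fix u v assume uv: "u \<in> qbasis I w" "v \<in> qbasis I w"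
  obtain j b z where u: "u = (j, b, z)" by (cases u)
  obtain j' b' z' where v: "v = (j', b', z')" by (cases v)
  have j: "j \<in> I" "j' \<in> I" "z < w" "card I \<noteq> 0"
    using uv assms by (auto simp: u v qbasis_def)
  define h where "h i = (2 / card I - of_bool (j = i)) * (2 / card I - of_bool (j' = i))" for i
  have "(\<Sum>k\<in>qbasis I w. cnj (grover_step I t k u) * grover_step I t k v)
      = complex_of_real (\<Sum>k\<in>qbasis I w. of_bool ((b, z) = (b', z')) * (if snd k = (b, z) then h (fst k) else 0))"
    unfolding of_real_sum
    by (intro sum.cong) (auto simp: grover_step_def u v h_def bit_sign_def)
  also have "\<dots> = complex_of_real (of_bool ((b, z) = (b', z')) * (\<Sum>i\<in>I. h i))"
    using assms j by (simp add: sum_qbasis_slice flip: sum_distrib_left)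
  also have "(\<Sum>i\<in>I. h i) = (\<Sum>i\<in>I. 4 / (card I)\<^sup>2 - (if i = j then 2 / card I else 0)
       - (if i = j' then 2 / card I else 0) + (if i = j then of_bool (j = j') else 0))"
    by (intro sum.cong) (auto simp: h_def power2_eq_square algebra_simps)
  also have "\<dots> = of_bool (j = j')"
    using assms j by (simp add: sum.distrib sum_subtractf power2_eq_square)
  also have "complex_of_real (of_bool ((b, z) = (b', z')) * of_bool (j = j')) = (if u = v then 1 else 0)"
    by (auto simp: u v)
  finally show "(\<Sum>k\<in>qbasis I w. cnj (grover_step I t k u) * grover_step I t k v) = (if u = v then 1 else 0)" .
qed

lemma apply_grover_step:
  assumes "finite I" "(j, b, z) \<in> qbasis I w"
    and \<psi>: "\<And>i. i \<in> I \<Longrightarrow> \<psi> (i, b, z) = complex_of_real (f i)"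
  shows "apply_mat (qbasis I w) (grover_step I t) \<psi> (j, b, z) = complex_of_real
     ((if z = t then bit_sign b else 1) * (2 / card I * (\<Sum>i\<in>I. f i) - f j))"
proof -
  have j: "j \<in> I" "z < w" using assms by (auto simp: qbasis_def)
  let ?p = "if z = t then bit_sign b else 1"
  have "apply_mat (qbasis I w) (grover_step I t) \<psi> (j, b, z) = complex_of_real
      (\<Sum>v\<in>qbasis I w. ?p * (if snd v = (b, z) then (2 / card I - of_bool (fst v = j)) * f (fst v) else 0))"
    unfolding apply_mat_def of_real_sum
  proof (intro sum.cong refl)
    fix v assume "v \<in> qbasis I w"
    then show "grover_step I t (j, b, z) v * \<psi> v = complex_of_real
        (?p * (if snd v = (b, z) then (2 / card I - of_bool (fst v = j)) * f (fst v) else 0))"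
      using \<psi>[of "fst v"] by (cases "snd v = (b, z)"; cases v)
        (auto simp: grover_step_def qbasis_def)
  qed
  also have "\<dots> = complex_of_real (?p * (\<Sum>i\<in>I. (2 / card I - of_bool (i = j)) * f i))"
    using j assms sum_qbasis_slice[of I z w b "\<lambda>i. (2 / card I - of_bool (i = j)) * f i"]
    by (simp flip: sum_distrib_left)
  also have "(\<Sum>i\<in>I. (2 / card I - of_bool (i = j)) * f i)
      = (\<Sum>i\<in>I. 2 / card I * f i - (if i = j then f j else 0))"
    by (intro sum.cong) (auto simp: algebra_simps)
  also have "\<dots> = 2 / card I * (\<Sum>i\<in>I. f i) - f j"
    using assms j by (simp add: sum_subtractf sum_distrib_left sum_divide_distrib)
  finally show ?thesis .
qed

lemma sum_qbasis:
  "(\<Sum>v\<in>qbasis I w. h v) = (\<Sum>j\<in>I. \<Sum>b\<in>UNIV. \<Sum>z<w. h (j, b, z))"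
  by (simp add: qbasis_def sum.cartesian_product case_prod_unfold del: UNIV_bool)

text \<open>
  In branch \<open>z\<close> of the workspace the answer bit is in the state \<open>|+\<rangle>\<close>, where queries have no effect,
  until it is turned into \<open>|-\<rangle>\<close> at time \<open>z\<close>; from then on queries act as phase queries. At the
  end the overlap with the state reached on the empty input is measured: it is \<open>1\<close> on the empty
  input, and otherwise an average of \<open>T\<close> terms whose sum is bounded independently of \<open>T\<close>.
\<close>

lemma nonempty_bounded_error_computable:
  assumes fin: "finite I" and ne: "I \<noteq> {}" and T: "sqrt (card I) + 1 \<le> real T"
  shows "bounded_error_computable I (\<lambda>x. x \<noteq> {}) T"
proof -
  define B where "B = qbasis I T"
  define N where "N = real (card I)"
  have N: "N \<ge> 1" using fin ne by (simp add: N_def Suc_leI card_gt_0_iff)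
  have T1: "T \<ge> 1" "real T \<ge> 1" using T real_sqrt_ge_zero[of "card I"] by linarith+
  have finB: "finite B" using fin by (simp add: B_def finite_qbasis)
  \<comment> \<open>The uniform amplitude on the \<open>2 * N * T\<close> labels.\<close>
  define c where "c = 1 / sqrt (2 * N * T)"
  have NT: "N * real T \<ge> 1" using mult_mono[OF N T1(2)] N by simp
  then have c2: "c\<^sup>2 = 1 / (2 * N * T)" by (simp add: c_def power_divide)
  have c1: "c \<noteq> 1" using NT c2 by auto
  \<comment> \<open>\<open>\<chi>\<close> is the start, with only branch 0 in |->;
    \<open>\<omega>\<close>, with all branches in |->, is the state after the last query on the
    empty input.\<close>
  define \<chi> where "\<chi> v = c * (if snd (snd v) = 0 then bit_sign (fst (snd v)) else 1)" for v :: "'a qlabel"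
  define \<omega> where "\<omega> v = c * bit_sign (fst (snd v))" for v :: "'a qlabel"
  obtain j0 where j0: "j0 \<in> I" using ne by blast
  \<comment> \<open>Answer bit \<open>False\<close> gives both vectors the value
    \<open>c \<noteq> 1\<close> at \<open>s\<close>, as the reflections require.\<close>
  define s where "s = (j0, False, 0::nat)"
  have s: "s \<in> B" using j0 T1 by (simp add: s_def B_def qbasis_def)
  have \<chi>s: "\<chi> s \<noteq> 1" and \<omega>s: "\<omega> s \<noteq> 1"
    using c1 by (simp_all add: \<chi>_def \<omega>_def s_def bit_sign_def)
  have "card B = 2 * card I * T"
    by (simp add: B_def qbasis_def card_cartesian_product)
  then have card_c: "card B * c\<^sup>2 = 1" using fin ne T1 by (simp add: c2 N_def)
  have "(\<chi> v)\<^sup>2 = c\<^sup>2" "(\<omega> v)\<^sup>2 = c\<^sup>2" for v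
    by (auto simp: \<chi>_def \<omega>_def bit_sign_def)
  then have norms: "(\<Sum>v\<in>B. (\<chi> v)\<^sup>2) = 1" "(\<Sum>v\<in>B. (\<omega> v)\<^sup>2) = 1"
    using card_c by simp_all
  define U where "U t = (if t = 0 then reflection s \<chi> else if t = T then reflection s \<omega>
    else grover_step I t)" for t
  have U: "unitary_on B (U t)" for t
    using unitary_on_reflection[OF finB s norms(1) \<chi>s] unitary_on_reflection[OF finB s norms(2) \<omega>s]
      unitary_on_grover_step[OF fin, of T t] by (simp add: U_def B_def)

  \<comment> \<open>Branch \<open>z\<close> has completed \<open>t - z\<close> iterations once
    \<open>z \<le> t\<close>; before that it is still uniform.\<close>
  have state: "qstate B U s x t (j, b, z) = complex_of_real
      (c * (if z \<le> t then bit_sign b * grover I x (t - z) j else 1))"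
    if "t < T" "(j, b, z) \<in> B" for x t j b z
    using that
  proof (induction t arbitrary: j b z)
    case 0
    then show ?case
      by (simp add: U_def apply_reflection_ket[where \<chi> = \<chi>, OF finB s \<chi>s]) (simp add: \<chi>_def)
  next
    case (Suc t)
    define f where "f i = c * (if z \<le> t then bit_sign b * (bit_sign (i \<in> x) * grover I x (t - z) i) else 1)" for i
    have "query_gate x (qstate B U s x t) (i, b, z) = complex_of_real (f i)" if "i \<in> I" for i
      using Suc.IH[of i "b \<noteq> (i \<in> x)" z] Suc.prems that
      by (auto simp: query_gate_def f_def bit_sign_xor B_def qbasis_def)
    then have "qstate B U s x (Suc t) (j, b, z) = complex_of_real
        ((if z = Suc t then bit_sign b else 1) * (2 / card I * (\<Sum>i\<in>I. f i) - f j))"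
      using Suc.prems by (simp add: U_def B_def apply_grover_step[OF fin])
    also have "(if z = Suc t then bit_sign b else 1) * (2 / card I * (\<Sum>i\<in>I. f i) - f j)
        = c * (if z \<le> Suc t then bit_sign b * grover I x (Suc t - z) j else 1)"
    proof (cases "z \<le> t")
      case True
      then have "(\<Sum>i\<in>I. f i) = c * bit_sign b * (\<Sum>i\<in>I. bit_sign (i \<in> x) * grover I x (t - z) i)"
        by (simp add: f_def sum_distrib_left mult_ac)
      then show ?thesis using True by (simp add: f_def Suc_diff_le algebra_simps)
    next
      case False
      \<comment> \<open>In a branch not yet active, the reflection fixes the constant
        vector.\<close>
      have "card I \<noteq> 0" using fin ne by simp
      then show ?thesis using False by (auto simp: f_def)
    qed
    finally show ?case .
  qed

  let ?fin = "\<lambda>x. qstate B U s x T"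
  define S where "S x = (\<Sum>m<T. \<Sum>i\<in>I. bit_sign (i \<in> x) * grover I x m i)" for x
  \<comment> \<open>Both answer bits contribute equally, as their signs square to 1, and
    \<open>2 * c^2 = 1 / (N * T)\<close>.\<close>
  have amp: "?fin x s = complex_of_real (S x / (N * T))" for x
  proof -
    obtain t where t: "T = Suc t" using T1 by (cases T) auto
    have "?fin x s = (\<Sum>v\<in>B. \<omega> v * query_gate x (qstate B U s x t) v)"
      using \<omega>s by (simp add: t U_def apply_reflection_base)
    also have "\<dots> = (\<Sum>v\<in>B. complex_of_real (c\<^sup>2 * (case v of (i, b, z) \<Rightarrow>
        bit_sign (i \<in> x) * grover I x (t - z) i)))"
    proof (intro sum.cong refl)
      fix v assume v: "v \<in> B"
      obtain i b z where "v = (i, b, z)" by (cases v)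
      then show "\<omega> v * query_gate x (qstate B U s x t) v = complex_of_real (c\<^sup>2 * (case v of (i, b, z) \<Rightarrow>
        bit_sign (i \<in> x) * grover I x (t - z) i))"
        using v t state[of t i "b \<noteq> (i \<in> x)" z x]
        by (auto simp: query_gate_def \<omega>_def bit_sign_xor B_def qbasis_def power2_eq_square simp flip: of_real_mult)
    qed
    also have "\<dots> = complex_of_real (c\<^sup>2 * (\<Sum>(i, b, z)\<in>B. bit_sign (i \<in> x) * grover I x (t - z) i))"
      by (simp add: sum_distrib_left)
    also have "(\<Sum>(i, b, z)\<in>B. bit_sign (i \<in> x) * grover I x (t - z) i)
        = 2 * (\<Sum>i\<in>I. \<Sum>z<T. bit_sign (i \<in> x) * grover I x (t - z) i)"
      by (simp add: B_def sum_qbasis UNIV_bool flip: sum_distrib_left)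
    \<comment> \<open>As \<open>z\<close> runs through the branches, \<open>t - z\<close> runs
      backwards through all \<open>m < T\<close>.\<close>
    also have "(\<Sum>i\<in>I. \<Sum>z<T. bit_sign (i \<in> x) * grover I x (t - z) i) = S x"
      unfolding S_def t by (subst sum.swap, subst sum.nat_diff_reindex[symmetric]) simp
    finally show ?thesis by (simp add: c2)
  qed

  define out where "out v \<longleftrightarrow> v \<noteq> s" for v
  have outF: "output_prob B out (?fin x) False = (S x / (N * T))\<^sup>2" for x
  proof -
    have "{v \<in> B. out v = False} = {s}" using s by (auto simp: out_def)
    then show ?thesis by (simp add: output_prob_def amp norm_divide norm_mult power_divide power_mult_distrib)
  qed
  have "output_prob B out (?fin x) (x \<noteq> {}) \<ge> 2/3" if x: "x \<subseteq> I" for x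
  proof (cases "x = {}")
    case True
    have "S x = N * T"
      using fin ne by (simp add: S_def True grover_empty bit_sign_def N_def)
    then show ?thesis using outF[of x] N T1 by (simp add: True)
  next
    case False
    then obtain j where "j \<in> x" by blast
    then have "\<bar>S x\<bar> \<le> N * (sqrt N + 1) / 2"
      using grover_sum_overlap_le[OF fin _ x] by (simp add: S_def N_def)
    also have "\<dots> \<le> N * T / 2" using T N by (simp add: N_def)
    \<comment> \<open>Overlap at most 1/2 means error probability at most 1/4.\<close>
    finally have "\<bar>S x / (N * T)\<bar> \<le> 1/2" using N T1 by (simp add: abs_mult field_simps)
    then have "(S x / (N * T))\<^sup>2 \<le> (1/2)\<^sup>2"
      using abs_le_square_iff[of "S x / (N * T)" "1/2"] by simp
    then show ?thesis
      using output_prob_complement[OF finB, of out "?fin x" False] outF[of x] False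
        qnorm_qstate[of I s T T U T x] fin s U by (simp add: B_def power2_eq_square)
  qed
  then show ?thesis
    unfolding bounded_error_computable_def using s U unfolding B_def by blast
qed

section \<open>Both bounds for \<open>Q2\<close>\<close>

theorem theorem15:
  shows "(\<exists>c>0. \<forall>n. \<forall>P. nonconst_mono_graph_property n P \<longrightarrow>
            ereal (c * sqrt (real n)) \<le> ereal_of_enat (Q2 (all_edges n) P))
       \<and> (\<exists>P :: nat \<Rightarrow> (nat \<times> nat) set \<Rightarrow> bool.
            (\<forall>n\<ge>2. nonconst_mono_graph_property n (P n)) \<and>
            (\<exists>C. \<forall>n\<ge>2. ereal_of_enat (Q2 (all_edges n) (P n)) \<le> ereal (C * real n)))"
proof (intro conjI)
  have "ereal (1/20 * sqrt n) \<le> ereal_of_enat (Q2 (all_edges n) P)"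
    if P: "nonconst_mono_graph_property n P" for n P
  proof (cases "Q2 (all_edges n) P")
    case (enat T)
    let ?A = "enat ` {T. bounded_error_computable (all_edges n) P T}"
    \<comment> \<open>The infimum of the empty set is infinite, so a finite \<open>Q2\<close> is
      attained by an algorithm.\<close>
    have "Q2 (all_edges n) P = \<infinity>" if "?A = {}"
      unfolding Q2_def Inf_enat_def that by simp
    then have "?A \<noteq> {}"
      using enat by auto
    then have "Q2 (all_edges n) P \<in> ?A"
      unfolding Q2_def Inf_enat_def using LeastI_ex[of "\<lambda>x. x \<in> ?A"] by auto
    then have "bounded_error_computable (all_edges n) P T"
      using enat by auto
    then show ?thesis
      using query_lower_bound[OF P] enat by simp
  qed simp
  then show "\<exists>c>0. \<forall>n. \<forall>P. nonconst_mono_graph_property n P \<longrightarrow>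
      ereal (c * sqrt (real n)) \<le> ereal_of_enat (Q2 (all_edges n) P)"
    by (intro exI[of _ "1/20"]) auto
next
  let ?P = "\<lambda>G :: (nat \<times> nat) set. G \<noteq> {}"
  have ne: "all_edges n \<noteq> {}" if "n \<ge> 2" for n
  proof -
    have "(0, 1) \<in> all_edges n" using that by (simp add: all_edges_def)
    then show ?thesis by blast
  qed
  then have "nonconst_mono_graph_property n ?P" if "n \<ge> 2" for n
    using that by (auto simp: nonconst_mono_graph_property_def graph_property_def
        monotone_property_def nonconstant_property_def)
  moreover have "ereal_of_enat (Q2 (all_edges n) ?P) \<le> ereal (2 * real n)" if "n \<ge> 2" for n
  proof -
    have "card (all_edges n) \<le> card ({..<n} \<times> {..<n})"
      by (intro card_mono) (auto simp: all_edges_def)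
    then have "real (card (all_edges n)) \<le> (real n)\<^sup>2"
      by (simp add: power2_eq_square flip: of_nat_mult)
    then have "sqrt (card (all_edges n)) \<le> real n"
      by (intro real_le_lsqrt) auto
    \<comment> \<open>\<open>2 * n\<close> suffices, since
      \<open>sqrt (card (all_edges n)) + 1 \<le> n + 1 \<le> 2 * n\<close>.\<close>
    then have "bounded_error_computable (all_edges n) ?P (2 * n)"
      using that ne by (intro nonempty_bounded_error_computable finite_all_edges) auto
    then have "Q2 (all_edges n) ?P \<le> enat (2 * n)"
      unfolding Q2_def by (intro Inf_lower) simp
    then have "ereal_of_enat (Q2 (all_edges n) ?P) \<le> ereal_of_enat (enat (2 * n))"
      by (simp only: ereal_of_enat_le_iff)
    then show ?thesis by simp
  qed
  ultimately show "\<exists>P :: nat \<Rightarrow> (nat \<times> nat) set \<Rightarrow> bool.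
      (\<forall>n\<ge>2. nonconst_mono_graph_property n (P n)) \<and>
      (\<exists>C. \<forall>n\<ge>2. ereal_of_enat (Q2 (all_edges n) (P n)) \<le> ereal (C * real n))"
    by (intro exI[of _ "\<lambda>_. ?P"] conjI exI[of _ 2]) auto
qed

end
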